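(* Let $K:X\to Y$ be a linear compact operator between Hilbert spaces with singular system $\{(\sigma_n,v_n,u_n)\}_{n\in\mathbb{N}}$, let $y^\delta\in Y$ and $\alpha>0$, and consider the functional $$\Phi_\alpha(x)=\|Kx-y^\delta\|_Y^2+\alpha\sum_{n\in\mathbb{N}}|\langle x,v_n\rangle|,\qquad x\in X.$$ Suppose that $K$ is diagonal in the $v_n$-basis. If a minimizer $x_\alpha^\delta\in X$ of $\Phi_\alpha$ over $X$ exists, then it can be expressed as $$x_\alpha^\delta=\sum_{n\in\mathbb{N}}\mathcal{S}_{\alpha/\sigma_n^2}\!\left(\frac{\langle y^\delta,u_n\rangle}{\sigma_n}\right)v_n=\sum_{n\in\mathbb{N}}\frac{1}{\sigma_n^2}\,\mathcal{S}_\alpha\big(\sigma_n\langle y^\delta,u_n\rangle\big)v_n .\qquad(\ast)$$ Furthermore, if $x_\alpha^\delta$ is given by $(\ast)$, then $x_\alpha^\delta$ is a minimizer of $\Phi_\alpha$ over $X$.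
   Context: For $\alpha>0$, the soft thresholding function $\mathcal{S}_\alpha:\mathbb{R}\to\mathbb{R}$ is $$\mathcal{S}_\alpha(t)=\begin{cases}t+\frac{\alpha}{2},& t\le-\frac{\alpha}{2},\\ 0,& |t|\le\frac{\alpha}{2},\\ t-\frac{\alpha}{2},& t\ge\frac{\alpha}{2}.\end{cases}$$ A singular system $\{(\sigma_n,v_n,u_n)\}_{n\in\mathbb{N}}$ of $K$ consists of the singular values $\sigma_n>0$ in decreasing order (with multiplicity), i.e. the square roots of the eigenvalues of $K^*K$, and orthonormal systems $\{v_n\}\subset X$, $\{u_n\}\subset Y$ of eigenvectors of $K^*K$ and $KK^*$ with $Kv_n=\sigma_nu_n$ and $K^*u_n=\sigma_nv_n$. The paper's convention is that these systems are complete: every $x\in X$ and $y\in Y$ satisfies $x=\sum_n\langle x,v_n\rangle v_n$ and $y=\sum_n\langle y,u_n\rangle u_n$. The Hilbert spaces are real. The hypothesis "$K$ is diagonal in the $v_n$-basis" is used in the form $Kx=\sum_n\sigma_n\langle x,v_n\rangle u_n$, so that $\Phi_\alpha(x)=\sum_n\big(|\sigma_n\langle x,v_n\rangle-\langle y^\delta,u_n\rangle|^2+\alpha|\langle x,v_n\rangle|\big)$. *)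

theory Defs
  imports "HOL-Analysis.Analysis"
begin

definition compact_operator ::
  "('a::real_normed_vector \<Rightarrow> 'b::real_normed_vector) \<Rightarrow> bool" where
  "compact_operator K \<longleftrightarrow>
     linear K \<and> (\<forall>B. bounded B \<longrightarrow> compact (closure (K ` B)))"

definition orthonormal_system :: "(nat \<Rightarrow> 'a::real_inner) \<Rightarrow> bool" where
  "orthonormal_system e \<longleftrightarrow> (\<forall>m n. e m \<bullet> e n = (if m = n then 1 else 0))"

definition complete_system :: "(nat \<Rightarrow> 'a::real_inner) \<Rightarrow> bool" where
  "complete_system e \<longleftrightarrow> (\<forall>x. (\<lambda>n. (x \<bullet> e n) *\<^sub>R e n) sums x)"

(* Both orthonormal systems are required to be complete. This is also why no separate clause
   says that every eigenvalue of K^* K is listed with its multiplicity: since v is an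
   orthonormal basis of eigenvectors, the sequence (sigma n)^2 lists all of them that way.
   On Hilbert spaces a compact K is bounded, so the constant adjoint is the Hilbert space
   adjoint K^*. *)
definition singular_system ::
  "('a::{real_inner,complete_space} \<Rightarrow> 'b::{real_inner,complete_space}) \<Rightarrow>
     (nat \<Rightarrow> real) \<Rightarrow> (nat \<Rightarrow> 'a) \<Rightarrow> (nat \<Rightarrow> 'b) \<Rightarrow> bool" where
  "singular_system K \<sigma> v u \<longleftrightarrow>
     (\<forall>n. \<sigma> n > 0) \<and> decseq \<sigma> \<and>
     orthonormal_system v \<and> complete_system v \<and>
     orthonormal_system u \<and> complete_system u \<and>
     (\<forall>n. adjoint K (K (v n)) = (\<sigma> n)\<^sup>2 *\<^sub>R v n) \<and>
     (\<forall>n. K (adjoint K (u n)) = (\<sigma> n)\<^sup>2 *\<^sub>R u n) \<and>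
     (\<forall>n. K (v n) = \<sigma> n *\<^sub>R u n) \<and>
     (\<forall>n. adjoint K (u n) = \<sigma> n *\<^sub>R v n)"

definition diagonal_operator ::
  "('a::real_inner \<Rightarrow> 'b::real_inner) \<Rightarrow>
     (nat \<Rightarrow> real) \<Rightarrow> (nat \<Rightarrow> 'a) \<Rightarrow> (nat \<Rightarrow> 'b) \<Rightarrow> bool" where
  "diagonal_operator K \<sigma> v u \<longleftrightarrow>
     (\<forall>x. (\<lambda>n. (\<sigma> n * (x \<bullet> v n)) *\<^sub>R u n) sums K x)"

definition soft_threshold :: "real \<Rightarrow> real \<Rightarrow> real" where
  "soft_threshold \<alpha> t =
     (if t \<le> - (\<alpha> / 2) then t + \<alpha> / 2
      else if \<bar>t\<bar> \<le> \<alpha> / 2 then 0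
      else t - \<alpha> / 2)"

(* The values are extended reals: the l^1 penalty is infinite when the coefficients of x
   are not absolutely summable. *)
definition l1_tikhonov ::
  "('a::real_inner \<Rightarrow> 'b::real_inner) \<Rightarrow> (nat \<Rightarrow> 'a) \<Rightarrow> 'b \<Rightarrow> real \<Rightarrow> 'a \<Rightarrow> ennreal" where
  "l1_tikhonov K v y \<alpha> x =
     ennreal ((norm (K x - y))\<^sup>2) + ennreal \<alpha> * (\<Sum>n. ennreal \<bar>x \<bullet> v n\<bar>)"

end

theory Submission
  imports Defs
begin

text \<open>
  Parseval's identity for the basis \<open>u\<close> and the diagonal form of \<open>K\<close> turn the functional into a
  sum of independent one-dimensional problems: its value at \<open>x\<close> is the sum over \<open>n\<close> of
  \<open>(\<sigma> n * t - y \<bullet> u n)\<^sup>2 + \<alpha> * \<bar>t\<bar>\<close> at \<open>t = x \<bullet> v n\<close>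
  (\<open>l1_tikhonov_eq_suminf_coordinate_cost\<close>). Each of them is strictly convex and is minimised
  exactly at the soft-thresholded coefficient; \<open>coordinate_cost_growth\<close> gives this in the
  quantitative form that a deviation \<open>r\<close> from the minimiser costs at least \<open>(\<sigma> n * r)\<^sup>2\<close>.

  So an \<open>x\<close> whose coefficients are all soft-thresholded is a minimiser by comparison term by term.
  For the converse, a given minimiser \<open>x\<close> is compared with the vector obtained from it by
  correcting a single coefficient, which raises no question of convergence. The value of that vector
  falls short of the value at \<open>x\<close> by at least the growth term; since the value at \<open>x\<close> is finite and
  minimal, this term vanishes. Completeness of \<open>v\<close> recovers \<open>x\<close> from its coefficients.
\<close>

text \<open>
  The optimality condition of the one-variable problem: twice the residual \<open>c - soft_threshold \<beta> c\<close>
  is a subgradient of \<open>\<beta> * \<bar>\<cdot>\<bar>\<close> at \<open>soft_threshold \<beta> c\<close>. Its product with \<open>t\<close> is at most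
  \<open>\<beta> * \<bar>t\<bar>\<close>, with equality at the thresholded point itself, so the first-order term in the
  expansion around that point is nonnegative.
\<close>

lemma soft_threshold_growth:
  assumes "\<beta> > 0"
  shows "(soft_threshold \<beta> c - c)\<^sup>2 + \<beta> * \<bar>soft_threshold \<beta> c\<bar> + (t - soft_threshold \<beta> c)\<^sup>2
           \<le> (t - c)\<^sup>2 + \<beta> * \<bar>t\<bar>"
proof -
  define s where "s = soft_threshold \<beta> c"
  define p where "p = c - s"
  have p: "\<bar>p\<bar> \<le> \<beta> / 2" and ps: "2 * p * s = \<beta> * \<bar>s\<bar>"
    using assms by (auto simp: p_def s_def soft_threshold_def algebra_simps)
  have "2 * p * t \<le> 2 * (\<bar>p\<bar> * \<bar>t\<bar>)"
    using abs_ge_self[of "p * t"] by (simp add: abs_mult)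
  also have "\<dots> \<le> \<beta> * \<bar>t\<bar>"
    using mult_right_mono[OF p, of "\<bar>t\<bar>"] by simp
  finally have "2 * p * t \<le> \<beta> * \<bar>t\<bar>" .
  moreover have "(t - c)\<^sup>2 = (s - c)\<^sup>2 + (t - s)\<^sup>2 - 2 * p * t + 2 * p * s"
    by (simp add: p_def power2_eq_square algebra_simps)
  ultimately show ?thesis
    using ps by (simp add: s_def)
qed

lemma soft_threshold_scale:
  assumes "r > 0"
  shows "soft_threshold (r * \<beta>) (r * t) = r * soft_threshold \<beta> t"
proof -
  have "r * t \<le> - (r * \<beta> / 2) \<longleftrightarrow> t \<le> - (\<beta> / 2)"
    using mult_le_cancel_left_pos[OF assms, of t "- (\<beta> / 2)"] by simp
  moreover have "\<bar>r * t\<bar> \<le> r * \<beta> / 2 \<longleftrightarrow> \<bar>t\<bar> \<le> \<beta> / 2"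
    using mult_le_cancel_left_pos[OF assms, of "\<bar>t\<bar>" "\<beta> / 2"] assms by (simp add: abs_mult)
  ultimately show ?thesis
    by (simp add: soft_threshold_def distrib_left right_diff_distrib) arith
qed

corollary soft_threshold_quotient:
  assumes "\<sigma> > 0"
  shows "1 / \<sigma>\<^sup>2 * soft_threshold \<alpha> (\<sigma> * b) = soft_threshold (\<alpha> / \<sigma>\<^sup>2) (b / \<sigma>)"
  using soft_threshold_scale[of "1 / \<sigma>\<^sup>2" \<alpha> "\<sigma> * b"] assms
  by (simp add: power2_eq_square)

definition coordinate_cost :: "real \<Rightarrow> real \<Rightarrow> real \<Rightarrow> real \<Rightarrow> real" where
  "coordinate_cost \<alpha> \<sigma> b t = (\<sigma> * t - b)\<^sup>2 + \<alpha> * \<bar>t\<bar>"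

text \<open>
  Dividing the cost by \<open>\<sigma>\<^sup>2\<close> gives the problem of \<open>soft_threshold_growth\<close> with \<open>\<alpha> / \<sigma>\<^sup>2\<close> and
  \<open>b / \<sigma>\<close>; this is the origin of the scaled threshold.
\<close>

lemma coordinate_cost_growth:
  fixes \<alpha> \<sigma> b t :: real
  assumes "\<alpha> > 0" "\<sigma> > 0"
  defines "s \<equiv> soft_threshold (\<alpha> / \<sigma>\<^sup>2) (b / \<sigma>)"
  shows "coordinate_cost \<alpha> \<sigma> b s + (\<sigma> * (t - s))\<^sup>2 \<le> coordinate_cost \<alpha> \<sigma> b t"
proof -
  have scale: "coordinate_cost \<alpha> \<sigma> b r = \<sigma>\<^sup>2 * ((r - b / \<sigma>)\<^sup>2 + \<alpha> / \<sigma>\<^sup>2 * \<bar>r\<bar>)" for r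
    using assms(2)
    by (simp add: coordinate_cost_def distrib_left power_mult_distrib[symmetric]
        right_diff_distrib)
  have "\<sigma>\<^sup>2 * ((s - b / \<sigma>)\<^sup>2 + \<alpha> / \<sigma>\<^sup>2 * \<bar>s\<bar> + (t - s)\<^sup>2)
          \<le> \<sigma>\<^sup>2 * ((t - b / \<sigma>)\<^sup>2 + \<alpha> / \<sigma>\<^sup>2 * \<bar>t\<bar>)"
    unfolding s_def using assms(1,2) by (intro mult_left_mono soft_threshold_growth) auto
  then show ?thesis
    by (simp add: scale distrib_left power_mult_distrib)
qed

text \<open>
  The inner product of \<open>x\<close> with its own expansion; continuity of the inner product allows it to be
  taken term by term.
\<close>

lemma parseval:
  assumes "complete_system e"
  shows "(\<lambda>n. (x \<bullet> e n)\<^sup>2) sums (norm x)\<^sup>2"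
proof -
  have "(\<lambda>n. (x \<bullet> e n) *\<^sub>R e n) sums x"
    using assms by (simp add: complete_system_def)
  then have "(\<lambda>n. x \<bullet> ((x \<bullet> e n) *\<^sub>R e n)) sums (x \<bullet> x)"
    by (rule bounded_linear.sums[OF bounded_linear_inner_right])
  then show ?thesis
    by (simp add: power2_eq_square[symmetric] power2_norm_eq_inner)
qed

lemma orthonormal_coefficient:
  assumes "orthonormal_system e" "(\<lambda>n. c n *\<^sub>R e n) sums x"
  shows "x \<bullet> e m = c m"
proof -
  have "(\<lambda>n. (c n *\<^sub>R e n) \<bullet> e m) sums (x \<bullet> e m)"
    by (rule bounded_linear.sums[OF bounded_linear_inner_left assms(2)])
  moreover have "(c n *\<^sub>R e n) \<bullet> e m = (if n = m then c n else 0)" for n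
    using assms(1) by (simp add: orthonormal_system_def)
  ultimately have "(\<lambda>n. if n = m then c n else 0) sums (x \<bullet> e m)"
    by simp
  then show ?thesis
    using sums_single[of m c] by (rule sums_unique2)
qed

lemma l1_tikhonov_eq_suminf_coordinate_cost:
  assumes "orthonormal_system u" "complete_system u" "diagonal_operator K \<sigma> v u" "\<alpha> > 0"
  shows "l1_tikhonov K v y \<alpha> x = (\<Sum>n. ennreal (coordinate_cost \<alpha> (\<sigma> n) (y \<bullet> u n) (x \<bullet> v n)))"
proof -
  have "(\<lambda>n. (\<sigma> n * (x \<bullet> v n)) *\<^sub>R u n) sums K x"
    using assms(3) by (simp add: diagonal_operator_def)
  then have "K x \<bullet> u n = \<sigma> n * (x \<bullet> v n)" for n
    by (rule orthonormal_coefficient[OF assms(1)])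
  then have "(\<lambda>n. (\<sigma> n * (x \<bullet> v n) - y \<bullet> u n)\<^sup>2) sums (norm (K x - y))\<^sup>2"
    using parseval[OF assms(2), of "K x - y"] by (simp add: inner_diff_left)
  then have "ennreal ((norm (K x - y))\<^sup>2) = (\<Sum>n. ennreal ((\<sigma> n * (x \<bullet> v n) - y \<bullet> u n)\<^sup>2))"
    by (simp add: sums_iff suminf_ennreal2)
  moreover have "ennreal \<alpha> * (\<Sum>n. ennreal \<bar>x \<bullet> v n\<bar>) = (\<Sum>n. ennreal (\<alpha> * \<bar>x \<bullet> v n\<bar>))"
    using assms(4) by (simp add: ennreal_mult)
  ultimately show ?thesis
    using assms(4) by (simp add: l1_tikhonov_def coordinate_cost_def suminf_add ennreal_plus)
qed

theorem theorem3p3: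
  fixes K :: "'a::{real_inner,complete_space} \<Rightarrow> 'b::{real_inner,complete_space}"
    and \<sigma> :: "nat \<Rightarrow> real" and v :: "nat \<Rightarrow> 'a" and u :: "nat \<Rightarrow> 'b"
    and y :: 'b and \<alpha> :: real
  assumes "compact_operator K"
    and "singular_system K \<sigma> v u"
    and "\<alpha> > 0"
    and "diagonal_operator K \<sigma> v u"
  shows "(\<forall>x. is_arg_min (l1_tikhonov K v y \<alpha>) (\<lambda>_. True) x \<longrightarrow>
           (\<lambda>n. soft_threshold (\<alpha> / (\<sigma> n)\<^sup>2) ((y \<bullet> u n) / \<sigma> n) *\<^sub>R v n) sums x \<and>
           (\<lambda>n. (1 / (\<sigma> n)\<^sup>2 * soft_threshold \<alpha> (\<sigma> n * (y \<bullet> u n))) *\<^sub>R v n) sums x) \<and>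
         (\<forall>x. (\<lambda>n. soft_threshold (\<alpha> / (\<sigma> n)\<^sup>2) ((y \<bullet> u n) / \<sigma> n) *\<^sub>R v n) sums x \<and>
           (\<lambda>n. (1 / (\<sigma> n)\<^sup>2 * soft_threshold \<alpha> (\<sigma> n * (y \<bullet> u n))) *\<^sub>R v n) sums x \<longrightarrow>
           is_arg_min (l1_tikhonov K v y \<alpha>) (\<lambda>_. True) x)"
proof -
  define s where "s n = soft_threshold (\<alpha> / (\<sigma> n)\<^sup>2) ((y \<bullet> u n) / \<sigma> n)" for n
  define f where "f n t = coordinate_cost \<alpha> (\<sigma> n) (y \<bullet> u n) t" for n t
  let ?\<Phi> = "l1_tikhonov K v y \<alpha>"
  have v: "orthonormal_system v" "complete_system v"
    and u: "orthonormal_system u" "complete_system u"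
    and pos: "\<sigma> n > 0" for n
    using assms(2) by (auto simp: singular_system_def)
  have cost: "?\<Phi> x = (\<Sum>n. ennreal (f n (x \<bullet> v n)))" for x
    unfolding f_def by (rule l1_tikhonov_eq_suminf_coordinate_cost[OF u assms(4,3)])
  have growth: "f n (s n) + (\<sigma> n * (t - s n))\<^sup>2 \<le> f n t" for n t
    unfolding f_def s_def by (rule coordinate_cost_growth[OF assms(3) pos])
  have f_nonneg: "f n t \<ge> 0" for n t
    using assms(3) by (simp add: f_def coordinate_cost_def)
  have forms_agree: "1 / (\<sigma> n)\<^sup>2 * soft_threshold \<alpha> (\<sigma> n * (y \<bullet> u n)) = s n" for n
    unfolding s_def by (rule soft_threshold_quotient[OF pos])

  have necessary: "(\<lambda>n. s n *\<^sub>R v n) sums x" if min: "is_arg_min ?\<Phi> (\<lambda>_. True) x" for x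
  proof -
    have le: "?\<Phi> x \<le> ?\<Phi> z" for z
      using min by (simp add: is_arg_min_def not_less)
    \<comment> \<open>Without finiteness the gain \<open>d\<close> below could not be cancelled against \<open>?\<Phi> x\<close>.\<close>
    have "?\<Phi> 0 < top"
      by (simp add: l1_tikhonov_def)
    then have finite: "?\<Phi> x < top"
      using le[of 0] by (rule le_less_trans[rotated])
    have "x \<bullet> v n = s n" for n
    proof -
      \<comment> \<open>Only the \<open>n\<close>-th coefficient of \<open>x\<close> is corrected; \<open>d\<close> is the guaranteed gain.\<close>
      define z where "z = x + (s n - x \<bullet> v n) *\<^sub>R v n"
      define d where "d = (\<sigma> n * (x \<bullet> v n - s n))\<^sup>2"
      have z: "z \<bullet> v m = (if m = n then s n else x \<bullet> v m)" for m
        using v(1) by (simp add: z_def inner_add_left orthonormal_system_def)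
      have "?\<Phi> z + ennreal d
              = (\<Sum>m. ennreal (f m (z \<bullet> v m))) + (\<Sum>m. if m = n then ennreal d else 0)"
        using sums_unique[OF sums_single[of n "\<lambda>_. ennreal d"]] by (simp add: cost)
      also have "\<dots> = (\<Sum>m. ennreal (f m (z \<bullet> v m)) + (if m = n then ennreal d else 0))"
        by (intro suminf_add summableI)
      also have "\<dots> \<le> ?\<Phi> x"
        unfolding cost
      proof (intro suminf_le summableI)
        fix m
        show "ennreal (f m (z \<bullet> v m)) + (if m = n then ennreal d else 0)
                \<le> ennreal (f m (x \<bullet> v m))"
          using growth[of n "x \<bullet> v n"] f_nonneg
          by (auto simp: z d_def simp flip: ennreal_plus intro!: ennreal_leI)
      qed
      finally have "?\<Phi> x + ennreal d \<le> ?\<Phi> x + 0"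
        using le[of z] by (metis add.right_neutral add_right_mono order_trans)
      then have "ennreal d = 0"
        using finite by (auto simp: ennreal_add_left_cancel_le)
      then show ?thesis
        using pos[of n] by (simp add: d_def ennreal_eq_0_iff)
    qed
    then show ?thesis
      using v(2)[unfolded complete_system_def, rule_format, of x] by simp
  qed

  have sufficient: "is_arg_min ?\<Phi> (\<lambda>_. True) x" if "(\<lambda>n. s n *\<^sub>R v n) sums x" for x
  proof -
    have "f n (x \<bullet> v n) \<le> f n t" for n t
      using growth[of n t] orthonormal_coefficient[OF v(1) that, of n]
      by (simp add: order_trans[rotated])
    then have "?\<Phi> x \<le> ?\<Phi> z" for z
      unfolding cost by (intro suminf_le summableI ennreal_leI)
    then show ?thesis
      by (simp add: is_arg_min_def not_less)
  qed

  show ?thesis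
    unfolding forms_agree s_def[symmetric] using necessary sufficient by blast
qed

end
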